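(* Let $\mathcal{G}=(\mathcal{S}_{\mathcal G},\mathcal{M}_{\mathcal G},\mathcal{B}(H_{\mathcal G}))$ and $\mathcal{H}=(\mathcal{S}_{\mathcal H},\mathcal{M}_{\mathcal H},\mathcal{B}(H_{\mathcal H}))$ be quantum graphs, and let $\mathcal{G}[\mathcal{H}]$ be their lexicographic product. Then $\chi_q(\mathcal{G}[\mathcal{H}])\leq \chi_{b,q}(\mathcal{G})$, where $b=\chi_q(\mathcal{H})$.
   Context: Quantum graphs. Hilbert spaces are complex; $\mathcal{M}'$ is the commutant of $\mathcal{M}$. An (irreflexive) quantum graph is a tuple $(\mathcal{S},\mathcal{M},\mathcal{B}(H))$ where $\mathcal{M}$ is a von Neumann subalgebra of $\mathcal{B}(H)$ and $\mathcal{S}\subseteq\mathcal{B}(H)$ is a linear subspace (operator space) closed under adjoints, with $\mathcal{M}'\mathcal{S}\mathcal{M}'\subseteq\mathcal{S}$, and with $\mathcal{S}\subseteq(\mathcal{M}')^{\perp}=\{X\in\mathcal{B}(H):\operatorname{tr}(XY^* )=0\ \forall\,Y\in\mathcal{M}'\}$, where $\operatorname{tr}$ is a faithful tracial state on $\mathcal{B}(H)$ (so $H$ is nonzero and finite-dimensional). Quantum $b$-fold colorings. Let $b\in\mathbb{N}$, $b\ge 1$, and $[c]=\{1,\dots,c\}$; $\binom{[c]}{b}$ is the set of $b$-element subsets of $[c]$. A $q$-$b$-fold coloring of $(\mathcal{S},\mathcal{M},\mathcal{B}(H))$ with $c$ colors consists of a nonzero finite-dimensional von Neumann algebra $\mathcal{N}$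 and (self-adjoint) projections $P_1,\dots,P_c\in\mathcal{M}\bar\otimes\mathcal{N}$ such that (1) the $P_a$ commute pairwise; (2) $\sum_{\{a_1,\dots,a_b\}\in\binom{[c]}{b}}P_{a_1}\cdots P_{a_b}=I_{\mathcal{M}\bar\otimes\mathcal{N}}$; (3) $P_a(X\otimes I_{\mathcal{N}})P_a=0$ for all $a\in[c]$ and $X\in\mathcal{S}$. $\chi_{b,q}$ is the minimum $c$ for which such a coloring exists ($\infty$ if none exists). Quantum chromatic number. $\chi_q(\mathcal{S},\mathcal{M},\mathcal{B}(H))$ is the minimum $c$ for which there are a nonzero finite-dimensional von Neumann algebra $\mathcal{N}$ and projections $P_1,\dots,P_c\in\mathcal{M}\bar\otimes\mathcal{N}$ with $\sum_{a=1}^cP_a=I$ and $P_a(X\otimes I_{\mathcal{N}})P_a=0$ for all $X\in\mathcal{S}$ and all $a$ ($\infty$ if none exists). Lexicographic product. $\mathcal{G}[\mathcal{H}]=(\mathcal{S}_{\mathcal K},\ \mathcal{M}_{\mathcal G}\bar\otimes\mathcal{M}_{\mathcal H},\ \mathcal{B}(H_{\mathcal G}\otimes H_{\mathcal H}))$ with $\mathcal{S}_{\mathcal K}=\mathcal{S}_{\mathcal G}\otimes\mathcal{B}(H_{\mathcal H})+\mathcal{M}_{\mathcal G}'\otimes\mathcal{S}_{\mathcal H}$. *)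

theory Defs
  imports "Jordan_Normal_Form.Schur_Decomposition" "Jordan_Normal_Form.VS_Connect"
    "HOL-Library.Extended_Nat"
begin

text \<open>
  A finite-dimensional Hilbert space is taken with a chosen orthonormal basis, that is, as
  $\mathbb{C}^n$ with its standard inner product, so that the operators on it are the
  complex matrices in \<^term>\<open>carrier_mat n n\<close> and \<^const>\<open>mat_adjoint\<close> is the adjoint.
\<close>

abbreviation mat_space :: "nat \<Rightarrow> (complex, complex mat) module" where
  "mat_space n \<equiv> module_mat TYPE(complex) n n"

definition lin_subspace :: "nat \<Rightarrow> complex mat set \<Rightarrow> bool" where
  "lin_subspace n V \<longleftrightarrow> VectorSpace.subspace class_ring V (mat_space n)"

definition lin_span :: "nat \<Rightarrow> complex mat set \<Rightarrow> complex mat set" where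
  "lin_span n V = LinearCombinations.module.span class_ring (mat_space n) V"

text \<open>
  Von Neumann algebras on $\mathbb{C}^n$ are the unital *-subalgebras: weak operator closedness
  is automatic, since every linear subspace of a finite-dimensional space is closed.
\<close>

definition vn_algebra :: "nat \<Rightarrow> complex mat set \<Rightarrow> bool" where
  "vn_algebra n M \<longleftrightarrow> lin_subspace n M \<and> 1\<^sub>m n \<in> M \<and>
     (\<forall>A\<in>M. \<forall>B\<in>M. A * B \<in> M) \<and> (\<forall>A\<in>M. mat_adjoint A \<in> M)"

definition commutant :: "nat \<Rightarrow> complex mat set \<Rightarrow> complex mat set" where
  "commutant n M = {X \<in> carrier_mat n n. \<forall>Y\<in>M. X * Y = Y * X}"

text \<open>The normalised trace is the only tracial state on the full matrix algebra.\<close>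

definition tracial_state :: "nat \<Rightarrow> complex mat \<Rightarrow> complex" where
  "tracial_state n X = (\<Sum>i<n. X $$ (i, i)) / of_nat n"

definition trace_perp :: "nat \<Rightarrow> complex mat set \<Rightarrow> complex mat set" where
  "trace_perp n V =
     {X \<in> carrier_mat n n. \<forall>Y\<in>V. tracial_state n (X * mat_adjoint Y) = 0}"

definition projection :: "nat \<Rightarrow> complex mat \<Rightarrow> bool" where
  "projection n P \<longleftrightarrow> P \<in> carrier_mat n n \<and> P * P = P \<and> mat_adjoint P = P"

text \<open>
  The Kronecker product represents $A \otimes B$ under the identification of
  $\mathbb{C}^n \otimes \mathbb{C}^k$ with $\mathbb{C}^{nk}$ sending $e_i \otimes e_j$ to
  $e_{ik+j}$.  It is strictly associative.
\<close>

definition kron :: "complex mat \<Rightarrow> complex mat \<Rightarrow> complex mat" where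
  "kron A B = mat (dim_row A * dim_row B) (dim_col A * dim_col B)
     (\<lambda>(i, j). A $$ (i div dim_row B, j div dim_col B) * B $$ (i mod dim_row B, j mod dim_col B))"

text \<open>
  Tensor product of operator spaces (no completion is needed in finite dimensions); for von
  Neumann algebras this is the von Neumann algebra tensor product.
\<close>

definition tensor :: "nat \<Rightarrow> complex mat set \<Rightarrow> nat \<Rightarrow> complex mat set \<Rightarrow> complex mat set" where
  "tensor n V k W = lin_span (n * k) {kron A B | A B. A \<in> V \<and> B \<in> W}"

text \<open>The tuple $(\mathcal{S}, \mathcal{M}, \mathcal{B}(\mathbb{C}^n))$, where $n$ is the field \<open>hdim\<close>.\<close>

record qgraph =
  opspace :: "complex mat set"
  alg :: "complex mat set"
  hdim :: nat

definition quantum_graph :: "qgraph \<Rightarrow> bool" where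
  "quantum_graph G \<longleftrightarrow>
     hdim G > 0 \<and>
     vn_algebra (hdim G) (alg G) \<and>
     lin_subspace (hdim G) (opspace G) \<and>
     (\<forall>X\<in>opspace G. mat_adjoint X \<in> opspace G) \<and>
     (\<forall>A\<in>commutant (hdim G) (alg G). \<forall>X\<in>opspace G. \<forall>B\<in>commutant (hdim G) (alg G).
        A * X * B \<in> opspace G) \<and>
     opspace G \<subseteq> trace_perp (hdim G) (commutant (hdim G) (alg G))"

definition lex_product :: "qgraph \<Rightarrow> qgraph \<Rightarrow> qgraph" where
  "lex_product G H =
     \<lparr> opspace = {X + Y | X Y.
         X \<in> tensor (hdim G) (opspace G) (hdim H) (carrier_mat (hdim H) (hdim H)) \<and>
         Y \<in> tensor (hdim G) (commutant (hdim G) (alg G)) (hdim H) (opspace H)},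
       alg = tensor (hdim G) (alg G) (hdim H) (alg H),
       hdim = hdim G * hdim H \<rparr>"

text \<open>
  In the colorings below the auxiliary algebra $\mathcal{N}$ ranges over the unital
  *-subalgebras of the matrix algebras of all sizes $k \ge 1$.  Up to isomorphism these are all
  the nonzero finite-dimensional von Neumann algebras.
\<close>

definition q_coloring ::
  "qgraph \<Rightarrow> nat \<Rightarrow> nat \<Rightarrow> complex mat set \<Rightarrow> (nat \<Rightarrow> complex mat) \<Rightarrow> bool" where
  "q_coloring G c k N P \<longleftrightarrow>
     k > 0 \<and> vn_algebra k N \<and>
     (\<forall>a\<in>{1..c}. P a \<in> tensor (hdim G) (alg G) k N \<and> projection (hdim G * k) (P a)) \<and>
     finsum (mat_space (hdim G * k)) P {1..c} = 1\<^sub>m (hdim G * k) \<and>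
     (\<forall>a\<in>{1..c}. \<forall>X\<in>opspace G.
        P a * kron X (1\<^sub>m k) * P a = 0\<^sub>m (hdim G * k) (hdim G * k))"

definition chi_q :: "qgraph \<Rightarrow> enat" where
  "chi_q G = (INF c \<in> {c. \<exists>k N P. q_coloring G c k N P}. enat c)"

text \<open>
  The product of the $P_a$ with $a$ in a finite set of colors, taken in increasing order of the
  colors; the order is immaterial when the $P_a$ commute.
\<close>

definition set_prod :: "nat \<Rightarrow> (nat \<Rightarrow> complex mat) \<Rightarrow> nat set \<Rightarrow> complex mat" where
  "set_prod d P A = foldr (*) (map P (sorted_list_of_set A)) (1\<^sub>m d)"

definition qb_coloring ::
  "nat \<Rightarrow> qgraph \<Rightarrow> nat \<Rightarrow> nat \<Rightarrow> complex mat set \<Rightarrow> (nat \<Rightarrow> complex mat) \<Rightarrow> bool" where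
  "qb_coloring b G c k N P \<longleftrightarrow>
     k > 0 \<and> vn_algebra k N \<and>
     (\<forall>a\<in>{1..c}. P a \<in> tensor (hdim G) (alg G) k N \<and> projection (hdim G * k) (P a)) \<and>
     (\<forall>a\<in>{1..c}. \<forall>a'\<in>{1..c}. P a * P a' = P a' * P a) \<and>
     finsum (mat_space (hdim G * k)) (set_prod (hdim G * k) P) {A. A \<subseteq> {1..c} \<and> card A = b}
       = 1\<^sub>m (hdim G * k) \<and>
     (\<forall>a\<in>{1..c}. \<forall>X\<in>opspace G.
        P a * kron X (1\<^sub>m k) * P a = 0\<^sub>m (hdim G * k) (hdim G * k))"

definition chi_bq :: "nat \<Rightarrow> qgraph \<Rightarrow> enat" where
  "chi_bq b G = (INF c \<in> {c. \<exists>k N P. qb_coloring b G c k N P}. enat c)"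

end

theory Submission
  imports Defs
begin

text \<open>
  Let $P_1, \dots, P_c$ be a $b$-fold coloring of $\mathcal{G}$ and $Q_1, \dots, Q_b$ a coloring of
  $\mathcal{H}$.  The products $E_A = \prod_{a \in A} P_a$ over the $b$-subsets $A$ of $[c]$ are
  commuting projections with sum $I$, hence mutually orthogonal.  Choosing bijections
  $g_A : A \to [b]$, the operators
  $R_a = \sum_{A \ni a} E_A \otimes Q_{g_A(a)}$, with tensor factors reordered, are projections that
  color $\mathcal{G}[\mathcal{H}]$.  They sum to $\sum_A E_A \otimes I = I$.  On
  $\mathcal{S}_{\mathcal G} \otimes \mathcal{B}(H_{\mathcal H})$ the compression by $R_a$ vanishes since
  $E_A = E_A P_a$ for $a \in A$; on $\mathcal{M}_{\mathcal G}' \otimes \mathcal{S}_{\mathcal H}$ the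
  first factor commutes with the $E_A$, so only the diagonal terms survive, and these vanish
  because $Q$ is a coloring.
\<close>

subsection \<open>Subspaces, adjoints and sums of matrices\<close>

text \<open>Replaces the abstract module notion by closure conditions on matrices, the form that
  almost all later subspace arguments use.\<close>

lemma lin_subspace_iff:
  "lin_subspace n V \<longleftrightarrow> V \<subseteq> carrier_mat n n \<and> 0\<^sub>m n n \<in> V \<and>
     (\<forall>A\<in>V. \<forall>B\<in>V. A + B \<in> V) \<and> (\<forall>c. \<forall>A\<in>V. c \<cdot>\<^sub>m A \<in> V)"
proof -
  interpret M: matrix_vs n n "TYPE(complex)" .
  show ?thesis
    unfolding lin_subspace_def VectorSpace.subspace_def submodule_def
    using M.vectorspace_axioms M.module_axioms by (auto simp: module_mat_simps)
qed

lemma lin_subspaceD: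
  assumes "lin_subspace n V"
  shows "V \<subseteq> carrier_mat n n" and "0\<^sub>m n n \<in> V"
    and "A \<in> V \<Longrightarrow> B \<in> V \<Longrightarrow> A + B \<in> V" and "A \<in> V \<Longrightarrow> c \<cdot>\<^sub>m A \<in> V"
  using assms unfolding lin_subspace_iff by auto

lemma lin_span:
  assumes "V \<subseteq> carrier_mat n n"
  shows lin_subspace_span: "lin_subspace n (lin_span n V)"
    and lin_span_superset: "V \<subseteq> lin_span n V"
    and lin_span_least: "lin_subspace n W \<Longrightarrow> V \<subseteq> W \<Longrightarrow> lin_span n V \<subseteq> W"
proof -
  interpret M: matrix_vs n n "TYPE(complex)" .
  show "lin_subspace n (lin_span n V)"
    unfolding lin_subspace_def lin_span_def by (rule M.span_is_subspace[OF assms])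
  show "V \<subseteq> lin_span n V"
    unfolding lin_span_def by (rule M.in_own_span[OF assms])
  show "lin_span n V \<subseteq> W" if "lin_subspace n W" "V \<subseteq> W"
    using M.span_is_subset[OF that(2)] that(1)
    unfolding lin_subspace_def lin_span_def VectorSpace.subspace_def by auto
qed

text \<open>The carrier matrices with property \<open>Q\<close> form a subspace that contains the
  generators, hence the whole span. Stability of \<open>Q\<close> is asked only on the carrier,
  where the laws of matrix algebra hold.\<close>

lemma lin_span_induct [consumes 2, case_names base zero add smult]:
  assumes "X \<in> lin_span n V" and "V \<subseteq> carrier_mat n n"
    and "\<And>X. X \<in> V \<Longrightarrow> Q X" and "Q (0\<^sub>m n n)"
    and "\<And>X Y. X \<in> carrier_mat n n \<Longrightarrow> Y \<in> carrier_mat n n \<Longrightarrow> Q X \<Longrightarrow> Q Y \<Longrightarrow> Q (X + Y)"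
    and "\<And>c X. X \<in> carrier_mat n n \<Longrightarrow> Q X \<Longrightarrow> Q (c \<cdot>\<^sub>m X)"
  shows "Q X"
proof -
  have "lin_subspace n {X \<in> carrier_mat n n. Q X}"
    unfolding lin_subspace_iff using assms(4-6) by auto
  then have "lin_span n V \<subseteq> {X \<in> carrier_mat n n. Q X}"
    using assms(2,3) by (intro lin_span_least) auto
  then show ?thesis using assms(1) by auto
qed

lemma vn_algebra_carrier: "vn_algebra n M \<Longrightarrow> M \<subseteq> carrier_mat n n"
  unfolding vn_algebra_def lin_subspace_iff by auto

section \<open>Adjoints and entries of products\<close>

lemma mat_adjoint_carrier [simp]: "A \<in> carrier_mat r c \<Longrightarrow> mat_adjoint A \<in> carrier_mat c r"
  unfolding mat_adjoint_def by auto

lemma mat_adjoint_index [simp]: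
  "i < dim_col A \<Longrightarrow> j < dim_row A \<Longrightarrow> mat_adjoint A $$ (i, j) = cnj (A $$ (j, i))"
  for A :: "complex mat"
  unfolding mat_adjoint_def mat_of_rows_def by (auto simp: conjugate_complex_def)

lemma mat_adjoint_dim [simp]:
  "dim_row (mat_adjoint A) = dim_col A" "dim_col (mat_adjoint A) = dim_row A"
  unfolding mat_adjoint_def by auto

lemma mat_mult_index:
  assumes "A \<in> carrier_mat r m" "B \<in> carrier_mat m c" "i < r" "j < c"
  shows "(A * B) $$ (i, j) = (\<Sum>h<m. A $$ (i, h) * B $$ (h, j))"
  using assms by (auto simp: scalar_prod_def atLeast0LessThan)

lemma mat_adjoint_mult:
  fixes A B :: "complex mat"
  assumes "A \<in> carrier_mat r m" "B \<in> carrier_mat m c"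
  shows "mat_adjoint (A * B) = mat_adjoint B * mat_adjoint A"
proof (rule eq_matI)
  fix i j assume "i < dim_row (mat_adjoint B * mat_adjoint A)"
    "j < dim_col (mat_adjoint B * mat_adjoint A)"
  then have ij: "i < c" "j < r" using assms by auto
  have "mat_adjoint (A * B) $$ (i, j) = cnj ((A * B) $$ (j, i))"
    using assms ij by (intro mat_adjoint_index) auto
  also have "\<dots> = (\<Sum>h<m. cnj (A $$ (j, h)) * cnj (B $$ (h, i)))"
    by (simp add: mat_mult_index[OF assms ij(2,1)])
  also have "\<dots> = (\<Sum>h<m. mat_adjoint B $$ (i, h) * mat_adjoint A $$ (h, j))"
    using assms ij by (intro sum.cong) auto
  also have "\<dots> = (mat_adjoint B * mat_adjoint A) $$ (i, j)"
    using assms ij by (subst mat_mult_index[where r = c and c = r and m = m]) auto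
  finally show "mat_adjoint (A * B) $$ (i, j) = (mat_adjoint B * mat_adjoint A) $$ (i, j)" .
qed (use assms in auto)

text \<open>An entrywise sum always has size \<open>d\<close> by \<open>d\<close>, and its
  identities reduce to finite sums of complex numbers; \<open>finsum_eq_msum\<close> connects it
  with the sums in the definitions of colorings.\<close>

definition msum :: "nat \<Rightarrow> ('a \<Rightarrow> complex mat) \<Rightarrow> 'a set \<Rightarrow> complex mat" where
  "msum d f S = mat d d (\<lambda>ij. \<Sum>s\<in>S. f s $$ ij)"

lemma msum_index [simp]: "i < d \<Longrightarrow> j < d \<Longrightarrow> msum d f S $$ (i, j) = (\<Sum>s\<in>S. f s $$ (i, j))"
  unfolding msum_def by auto

lemma msum_carrier [simp]: "msum d f S \<in> carrier_mat d d"
  and msum_dim [simp]: "dim_row (msum d f S) = d" "dim_col (msum d f S) = d"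
  unfolding msum_def by auto

lemma msum_cong: "(\<And>s. s \<in> S \<Longrightarrow> f s = g s) \<Longrightarrow> msum d f S = msum d g S"
  unfolding msum_def by auto

lemma msum_insert:
  assumes "finite S" "s \<notin> S" "f s \<in> carrier_mat d d"
  shows "msum d f (insert s S) = f s + msum d f S"
  by (rule eq_matI) (use assms in auto)

lemma finsum_eq_msum:
  assumes "finite S" "\<And>s. s \<in> S \<Longrightarrow> f s \<in> carrier_mat d d"
  shows "finsum (mat_space d) f S = msum d f S"
  using assms
proof (induction S rule: finite_induct)
  interpret M: matrix_vs d d "TYPE(complex)" .
  case empty
  show ?case by (rule eq_matI) auto
next
  interpret M: matrix_vs d d "TYPE(complex)" .
  case (insert s S)
  have "finsum (mat_space d) f (insert s S) = f s + finsum (mat_space d) f S"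
    using insert by (intro M.finsum_insert) auto
  with insert show ?case by (simp add: msum_insert)
qed

lemma msum_in_lin_subspace:
  assumes "lin_subspace d V" "finite S" "\<And>s. s \<in> S \<Longrightarrow> f s \<in> V"
  shows "msum d f S \<in> V"
  using assms(2,3)
proof (induction S rule: finite_induct)
  case empty
  have "msum d f {} = 0\<^sub>m d d" by (rule eq_matI) auto
  then show ?case using lin_subspaceD(2)[OF assms(1)] by simp
next
  case (insert s S)
  have "f s \<in> carrier_mat d d" using insert lin_subspaceD(1)[OF assms(1)] by auto
  then show ?case using insert lin_subspaceD(3)[OF assms(1)] by (simp add: msum_insert)
qed

lemma msum_mult:
  assumes "\<And>s. s \<in> S \<Longrightarrow> f s \<in> carrier_mat d d" "B \<in> carrier_mat d d"
  shows msum_mult_right: "msum d f S * B = msum d (\<lambda>s. f s * B) S"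
    and msum_mult_left: "B * msum d f S = msum d (\<lambda>s. B * f s) S"
proof -
  show "msum d f S * B = msum d (\<lambda>s. f s * B) S"
  proof (rule eq_matI)
    fix i j assume "i < dim_row (msum d (\<lambda>s. f s * B) S)" "j < dim_col (msum d (\<lambda>s. f s * B) S)"
    then have ij: "i < d" "j < d" by auto
    have "(msum d f S * B) $$ (i, j) = (\<Sum>h<d. \<Sum>s\<in>S. f s $$ (i, h) * B $$ (h, j))"
      using ij assms by (subst mat_mult_index[where m = d and r = d and c = d])
        (auto simp: sum_distrib_right)
    also have "\<dots> = (\<Sum>s\<in>S. (f s * B) $$ (i, j))"
      using ij assms
      by (subst sum.swap) (auto intro!: sum.cong simp: mat_mult_index[where m = d and r = d and c = d]
          simp del: index_mult_mat)
    finally show "(msum d f S * B) $$ (i, j) = msum d (\<lambda>s. f s * B) S $$ (i, j)"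
      using ij by simp
  qed (use assms in auto)
  show "B * msum d f S = msum d (\<lambda>s. B * f s) S"
  proof (rule eq_matI)
    fix i j assume "i < dim_row (msum d (\<lambda>s. B * f s) S)" "j < dim_col (msum d (\<lambda>s. B * f s) S)"
    then have ij: "i < d" "j < d" by auto
    have "(B * msum d f S) $$ (i, j) = (\<Sum>h<d. \<Sum>s\<in>S. B $$ (i, h) * f s $$ (h, j))"
      using ij assms by (subst mat_mult_index[where m = d and r = d and c = d])
        (auto simp: sum_distrib_left)
    also have "\<dots> = (\<Sum>s\<in>S. (B * f s) $$ (i, j))"
      using ij assms
      by (subst sum.swap) (auto intro!: sum.cong simp: mat_mult_index[where m = d and r = d and c = d]
          simp del: index_mult_mat)
    finally show "(B * msum d f S) $$ (i, j) = msum d (\<lambda>s. B * f s) S $$ (i, j)"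
      using ij by simp
  qed (use assms in auto)
qed

lemma msum_swap:
  "msum d (\<lambda>s. msum d (f s) T) S = msum d (\<lambda>t. msum d (\<lambda>s. f s t) S) T"
  by (rule eq_matI) (auto intro: sum.swap)

lemma msum_eq_single:
  assumes "finite S" "s \<in> S" "f s \<in> carrier_mat d d"
    and "\<And>t. t \<in> S \<Longrightarrow> t \<noteq> s \<Longrightarrow> f t = 0\<^sub>m d d"
  shows "msum d f S = f s"
proof (rule eq_matI)
  fix i j assume "i < dim_row (f s)" "j < dim_col (f s)"
  then have ij: "i < d" "j < d" using assms by auto
  have "(\<Sum>t\<in>S. f t $$ (i, j)) = (\<Sum>t\<in>{s}. f t $$ (i, j))"
    using assms ij by (intro sum.mono_neutral_right) auto
  then show "msum d f S $$ (i, j) = f s $$ (i, j)" using ij by simp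
qed (use assms in auto)

lemma msum_zero:
  assumes "\<And>s. s \<in> S \<Longrightarrow> f s = 0\<^sub>m d d"
  shows "msum d f S = 0\<^sub>m d d"
  by (rule eq_matI) (use assms in auto)

lemma mat_adjoint_msum:
  assumes "\<And>s. s \<in> S \<Longrightarrow> f s \<in> carrier_mat d d"
  shows "mat_adjoint (msum d f S) = msum d (\<lambda>s. mat_adjoint (f s)) S"
proof (rule eq_matI)
  fix i j assume "i < dim_row (msum d (\<lambda>s. mat_adjoint (f s)) S)"
    "j < dim_col (msum d (\<lambda>s. mat_adjoint (f s)) S)"
  then have ij: "i < d" "j < d" by auto
  have "mat_adjoint (f s) $$ (i, j) = cnj (f s $$ (j, i))" if "s \<in> S" for s
    using assms[OF that] ij by (intro mat_adjoint_index) auto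
  then show "mat_adjoint (msum d f S) $$ (i, j) = msum d (\<lambda>s. mat_adjoint (f s)) S $$ (i, j)"
    using ij by (simp add: cnj_sum)
qed auto

subsection \<open>Kronecker products\<close>

text \<open>
  Any bijection from the \<open>d\<close> indices onto pairs of indices identifies $\mathbb{C}^d$ with
  $\mathbb{C}^p \otimes \mathbb{C}^q$.  Besides the standard one, behind \<^const>\<open>kron\<close>, the proof
  uses the one of \<open>shuffle_fst\<close> and \<open>shuffle_snd\<close> below.
\<close>

locale index_split =
  fixes d p q :: nat and \<phi> \<psi> :: "nat \<Rightarrow> nat"
  assumes bij: "bij_betw (\<lambda>i. (\<phi> i, \<psi> i)) {..<d} ({..<p} \<times> {..<q})"
begin

text \<open>With the basis vector of index \<open>i\<close> identified with the tensor of those of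
  indices \<open>\<phi> i\<close> and \<open>\<psi> i\<close>, this is the operator A tensor B. One
  calculus then serves both the Kronecker product and the reordering of factors.\<close>

definition tens :: "complex mat \<Rightarrow> complex mat \<Rightarrow> complex mat" where
  "tens A B = mat d d (\<lambda>(i, j). A $$ (\<phi> i, \<phi> j) * B $$ (\<psi> i, \<psi> j))"

lemma index_less [simp]: "i < d \<Longrightarrow> \<phi> i < p" "i < d \<Longrightarrow> \<psi> i < q"
  using bij_betwE[OF bij] by auto

lemma tens_carrier [simp]: "tens A B \<in> carrier_mat d d"
  and tens_dim [simp]: "dim_row (tens A B) = d" "dim_col (tens A B) = d"
  unfolding tens_def by auto

lemma tens_index [simp]:
  "i < d \<Longrightarrow> j < d \<Longrightarrow> tens A B $$ (i, j) = A $$ (\<phi> i, \<phi> j) * B $$ (\<psi> i, \<psi> j)"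
  unfolding tens_def by auto

text \<open>The mixed-product rule: through the bijection the sum over the intermediate index
  becomes a sum over pairs, which factors into the two matrix products.\<close>

lemma tens_mult:
  assumes "A \<in> carrier_mat p p" "A' \<in> carrier_mat p p" "B \<in> carrier_mat q q" "B' \<in> carrier_mat q q"
  shows "tens A B * tens A' B' = tens (A * A') (B * B')"
proof (rule eq_matI)
  fix i j assume "i < dim_row (tens (A * A') (B * B'))" "j < dim_col (tens (A * A') (B * B'))"
  then have ij: "i < d" "j < d" by auto
  have "(tens A B * tens A' B') $$ (i, j)
      = (\<Sum>h<d. (\<lambda>(x, y). (A $$ (\<phi> i, x) * A' $$ (x, \<phi> j)) * (B $$ (\<psi> i, y) * B' $$ (y, \<psi> j))) (\<phi> h, \<psi> h))"
    using ij by (subst mat_mult_index[where m = d and r = d and c = d])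
      (auto intro!: sum.cong simp: algebra_simps)
  also have "\<dots> = (\<Sum>(x, y)\<in>{..<p} \<times> {..<q}.
      (A $$ (\<phi> i, x) * A' $$ (x, \<phi> j)) * (B $$ (\<psi> i, y) * B' $$ (y, \<psi> j)))"
    by (rule sum.reindex_bij_betw[OF bij])
  also have "\<dots> = (A * A') $$ (\<phi> i, \<phi> j) * (B * B') $$ (\<psi> i, \<psi> j)"
    using assms ij
    by (simp add: mat_mult_index[where m = p and r = p and c = p]
        mat_mult_index[where m = q and r = q and c = q] sum_product sum.cartesian_product
        del: index_mult_mat)
  finally show "(tens A B * tens A' B') $$ (i, j) = tens (A * A') (B * B') $$ (i, j)"
    using ij by simp
qed auto

text \<open>Injectivity of the index pairing: two indices are equal exactly when both of their
  components are.\<close>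

lemma tens_one: "tens (1\<^sub>m p) (1\<^sub>m q) = 1\<^sub>m d"
proof (rule eq_matI)
  fix i j assume "i < dim_row (1\<^sub>m d :: complex mat)" "j < dim_col (1\<^sub>m d :: complex mat)"
  then have ij: "i < d" "j < d" by auto
  then have "i = j \<longleftrightarrow> \<phi> i = \<phi> j \<and> \<psi> i = \<psi> j"
    using bij_betw_imp_inj_on[OF bij] by (auto simp: inj_on_def)
  with ij show "tens (1\<^sub>m p) (1\<^sub>m q) $$ (i, j) = 1\<^sub>m d $$ (i, j)" by auto
qed auto

lemma tens_adjoint:
  assumes "A \<in> carrier_mat p p" "B \<in> carrier_mat q q"
  shows "mat_adjoint (tens A B) = tens (mat_adjoint A) (mat_adjoint B)"
  by (rule eq_matI) (use assms in auto)

lemma tens_add_left: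
  assumes "A \<in> carrier_mat p p" "A' \<in> carrier_mat p p"
  shows "tens (A + A') B = tens A B + tens A' B"
  by (rule eq_matI) (use assms in \<open>auto simp: algebra_simps\<close>)

lemma tens_add_right:
  assumes "B \<in> carrier_mat q q" "B' \<in> carrier_mat q q"
  shows "tens A (B + B') = tens A B + tens A B'"
  by (rule eq_matI) (use assms in \<open>auto simp: algebra_simps\<close>)

lemma tens_smult_left:
  assumes "A \<in> carrier_mat p p"
  shows "tens (c \<cdot>\<^sub>m A) B = c \<cdot>\<^sub>m tens A B"
  by (rule eq_matI) (use assms in auto)

lemma tens_smult_right:
  assumes "B \<in> carrier_mat q q"
  shows "tens A (c \<cdot>\<^sub>m B) = c \<cdot>\<^sub>m tens A B"
  by (rule eq_matI) (use assms in auto)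

lemma tens_zero: "tens (0\<^sub>m p p) B = 0\<^sub>m d d" "tens A (0\<^sub>m q q) = 0\<^sub>m d d"
  by (rule eq_matI; auto)+

lemma tens_msum_left: "tens (msum p f S) B = msum d (\<lambda>s. tens (f s) B) S"
  by (rule eq_matI) (auto simp: sum_distrib_right)

lemma tens_msum_right: "tens A (msum q f S) = msum d (\<lambda>s. tens A (f s)) S"
  by (rule eq_matI) (auto simp: sum_distrib_left)

end

section \<open>The standard Kronecker product and tensor products of algebras\<close>

lemma add_mult_less: "x < p \<Longrightarrow> y < q \<Longrightarrow> x * q + y < p * q" for x y p q :: nat
proof -
  assume "x < p" "y < q"
  then have "x * q + y < Suc x * q" by simp
  also have "\<dots> \<le> p * q" using \<open>x < p\<close> by (intro mult_le_mono1) simp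
  finally show ?thesis .
qed

text \<open>Division with remainder by \<open>q\<close>. For \<open>q = 0\<close> both sides are
  empty.\<close>

lemma bij_betw_div_mod:
  "bij_betw (\<lambda>i. (i div q, i mod q)) {..<p * q} ({..<p} \<times> {..<q})" for p q :: nat
proof (rule bij_betwI[where g = "\<lambda>(x, y). x * q + y"])
  show "(\<lambda>i. (i div q, i mod q)) \<in> {..<p * q} \<rightarrow> {..<p} \<times> {..<q}"
    by (auto simp: less_mult_imp_div_less intro!: mod_less_divisor gr0I)
  show "(\<lambda>(x, y). x * q + y) \<in> {..<p} \<times> {..<q} \<rightarrow> {..<p * q}"
    by (auto intro: add_mult_less)
qed auto

interpretation kr: index_split "p * q" p q "\<lambda>i. i div q" "\<lambda>i. i mod q" for p q
  by unfold_locales (rule bij_betw_div_mod)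

text \<open>\<open>kron\<close> reads the sizes off its arguments while \<open>kr.tens\<close> has
  them as parameters; for square matrices of these sizes the two agree, which opens
  \<open>kron\<close> to the calculus above.\<close>

lemma kron_eq_tens:
  assumes "A \<in> carrier_mat p p" "B \<in> carrier_mat q q"
  shows "kron A B = kr.tens p q A B"
  using assms unfolding kron_def kr.tens_def by auto

lemma tensor_generators_carrier:
  assumes "V \<subseteq> carrier_mat n n" "W \<subseteq> carrier_mat k k"
  shows "{kron A B | A B. A \<in> V \<and> B \<in> W} \<subseteq> carrier_mat (n * k) (n * k)"
proof clarify
  fix A B assume "A \<in> V" "B \<in> W"
  then have "kron A B = kr.tens n k A B" using assms by (intro kron_eq_tens) auto
  then show "kron A B \<in> carrier_mat (n * k) (n * k)" by simp
qed

lemma lin_subspace_tensor: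
  assumes "V \<subseteq> carrier_mat n n" "W \<subseteq> carrier_mat k k"
  shows "lin_subspace (n * k) (tensor n V k W)"
  unfolding tensor_def by (rule lin_subspace_span[OF tensor_generators_carrier[OF assms]])

lemma tens_in_tensor:
  assumes "V \<subseteq> carrier_mat n n" "W \<subseteq> carrier_mat k k" "A \<in> V" "B \<in> W"
  shows "kr.tens n k A B \<in> tensor n V k W"
proof -
  have "kr.tens n k A B = kron A B"
    using assms by (intro kron_eq_tens[symmetric]) auto
  then show ?thesis
    unfolding tensor_def
    using lin_span_superset[OF tensor_generators_carrier[OF assms(1,2)]] assms(3,4) by auto
qed

text \<open>Reduces linear statements about a tensor product of spaces to elementary tensors,
  written with \<open>kr.tens\<close> so that the mixed-product rule applies.\<close>

lemma tensor_induct [consumes 3, case_names base zero add smult]: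
  assumes "X \<in> tensor n V k W" and "V \<subseteq> carrier_mat n n" "W \<subseteq> carrier_mat k k"
    and "\<And>A B. A \<in> V \<Longrightarrow> B \<in> W \<Longrightarrow> Q (kr.tens n k A B)"
    and "Q (0\<^sub>m (n * k) (n * k))"
    and "\<And>X Y. X \<in> carrier_mat (n * k) (n * k) \<Longrightarrow> Y \<in> carrier_mat (n * k) (n * k) \<Longrightarrow>
      Q X \<Longrightarrow> Q Y \<Longrightarrow> Q (X + Y)"
    and "\<And>c X. X \<in> carrier_mat (n * k) (n * k) \<Longrightarrow> Q X \<Longrightarrow> Q (c \<cdot>\<^sub>m X)"
  shows "Q X"
  using assms(1)[unfolded tensor_def] tensor_generators_carrier[OF assms(2,3)]
proof (induction rule: lin_span_induct)
  case (base X)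
  then obtain A B where AB: "X = kron A B" "A \<in> V" "B \<in> W" by auto
  then have "X = kr.tens n k A B"
    using assms(2,3) by (auto intro: kron_eq_tens)
  then show ?case using assms(4)[OF AB(2,3)] by simp
qed (use assms in auto)

lemma mat_adjoint_zero: "mat_adjoint (0\<^sub>m r c :: complex mat) = 0\<^sub>m c r"
  by (rule eq_matI) auto

lemma mat_adjoint_add:
  fixes A B :: "complex mat"
  assumes "A \<in> carrier_mat r c" "B \<in> carrier_mat r c"
  shows "mat_adjoint (A + B) = mat_adjoint A + mat_adjoint B"
  by (rule eq_matI) (use assms in auto)

lemma mat_adjoint_smult:
  fixes A :: "complex mat"
  shows "mat_adjoint (c \<cdot>\<^sub>m A) = cnj c \<cdot>\<^sub>m mat_adjoint A"
  by (rule eq_matI) auto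

text \<open>The product is bilinear and the adjoint conjugate-linear, so closure need only be
  checked on elementary tensors, where both operations act factor by factor. Bilinearity is used by
  an induction on each argument in turn.\<close>

lemma vn_algebra_tensor:
  assumes M: "vn_algebra n M" and N: "vn_algebra k N"
  shows "vn_algebra (n * k) (tensor n M k N)"
proof -
  let ?T = "tensor n M k N" and ?d = "n * k"
  note car = vn_algebra_carrier[OF M] vn_algebra_carrier[OF N]
  note sub = lin_subspace_tensor[OF car]
  note T = lin_subspaceD[OF sub]
  have "1\<^sub>m ?d \<in> ?T"
    using tens_in_tensor[OF car, of "1\<^sub>m n" "1\<^sub>m k"] M N
    unfolding vn_algebra_def by (simp add: kr.tens_one)
  moreover have "X * Y \<in> ?T" if X: "X \<in> ?T" and Y: "Y \<in> ?T" for X Y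
    using X car
  proof (induction X rule: tensor_induct)
    case (base A B)
    note AB = this
    show ?case using Y car
    proof (induction Y rule: tensor_induct)
      case (base A' B')
      have "kr.tens n k A B * kr.tens n k A' B' = kr.tens n k (A * A') (B * B')"
        using AB base car by (intro kr.tens_mult) auto
      also have "\<dots> \<in> ?T"
        using AB base M N car unfolding vn_algebra_def by (intro tens_in_tensor) auto
      finally show ?case .
    next
      case zero
      then show ?case using T(2) by (simp add: right_mult_zero_mat[where n = ?d])
    next
      case (add X Y)
      then show ?case
        using T(3) by (simp add: mult_add_distrib_mat[where nr = ?d and n = ?d and nc = ?d])
    next
      case (smult c X)
      then show ?case
        using T(4) by (simp add: mult_smult_distrib[where nr = ?d and n = ?d and nc = ?d])
    qed
  next
    case zero
    have "0\<^sub>m ?d ?d * Y = 0\<^sub>m ?d ?d" using Y T(1) by (intro left_mult_zero_mat) auto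
    then show ?case using T(2) by simp
  next
    case (add X X')
    have "(X + X') * Y = X * Y + X' * Y"
      using add Y T(1) by (intro add_mult_distrib_mat[where nr = ?d and n = ?d and nc = ?d]) auto
    then show ?case using add T(3) by simp
  next
    case (smult c X)
    have "(c \<cdot>\<^sub>m X) * Y = c \<cdot>\<^sub>m (X * Y)"
      using smult Y T(1) by (intro mult_smult_assoc_mat[where nr = ?d and n = ?d and nc = ?d]) auto
    then show ?case using smult T(4) by simp
  qed
  moreover have "mat_adjoint X \<in> ?T" if X: "X \<in> ?T" for X
    using X car
  proof (induction X rule: tensor_induct)
    case (base A B)
    have "mat_adjoint (kr.tens n k A B) = kr.tens n k (mat_adjoint A) (mat_adjoint B)"
      using base car by (intro kr.tens_adjoint) auto
    also have "\<dots> \<in> ?T"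
      using base car M N unfolding vn_algebra_def by (intro tens_in_tensor) auto
    finally show ?case .
  next
    case zero
    then show ?case using T(2) by (simp add: mat_adjoint_zero)
  next
    case (add X Y)
    then show ?case using T(3) by (simp add: mat_adjoint_add[where r = ?d and c = ?d])
  next
    case (smult c X)
    then show ?case using T(4) by (simp add: mat_adjoint_smult)
  qed
  ultimately show ?thesis unfolding vn_algebra_def using sub by auto
qed

text \<open>On an elementary tensor only the first factors meet, and these commute; linearity does
  the rest. Later this moves operators from the commutant of the algebra of G past the projections
  of a coloring.\<close>

lemma commutant_tensor_commutes:
  assumes "M \<subseteq> carrier_mat n n" "N \<subseteq> carrier_mat k k"
    and "Z \<in> commutant n M" and "X \<in> tensor n M k N"
  shows "kr.tens n k Z (1\<^sub>m k) * X = X * kr.tens n k Z (1\<^sub>m k)"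
  using assms(4,1,2)
proof (induction X rule: tensor_induct)
  let ?d = "n * k"
  have Z: "Z \<in> carrier_mat n n" "\<And>Y. Y \<in> M \<Longrightarrow> Z * Y = Y * Z"
    using assms(3) unfolding commutant_def by auto
  {
    case (base A B)
    then have "A \<in> carrier_mat n n" "B \<in> carrier_mat k k" using assms by auto
    with Z base show ?case by (simp add: kr.tens_mult)
  next
    case zero
    then show ?case
      by (simp add: left_mult_zero_mat[where nr = ?d] right_mult_zero_mat[where n = ?d])
  next
    case (add X Y)
    then show ?case
      by (simp add: mult_add_distrib_mat[where nr = ?d and n = ?d and nc = ?d]
          add_mult_distrib_mat[where nr = ?d and n = ?d and nc = ?d])
  next
    case (smult c X)
    then show ?case
      by (simp add: mult_smult_distrib[where nr = ?d and n = ?d and nc = ?d]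
          mult_smult_assoc_mat[where nr = ?d and n = ?d and nc = ?d])
  }
qed

section \<open>Exchange of the two middle tensor factors\<close>

lemma add_mult_div_mod: "y < q \<Longrightarrow> (x * q + y) div q = x" "y < q \<Longrightarrow> (x * q + y) mod q = y"
  for x y q :: nat
  by simp_all

text \<open>
  The index of $e_x \otimes e_y \otimes e_z \otimes e_w$ in
  $\mathbb{C}^n \otimes \mathbb{C}^m \otimes \mathbb{C}^k \otimes \mathbb{C}^l$ is sent to the index
  of $e_x \otimes e_z$ in $\mathbb{C}^{nk}$ and that of $e_y \otimes e_w$ in $\mathbb{C}^{ml}$.
\<close>

definition shuffle_fst :: "nat \<Rightarrow> nat \<Rightarrow> nat \<Rightarrow> nat \<Rightarrow> nat" where
  "shuffle_fst m k l i = (i div (k * l) div m) * k + i mod (k * l) div l"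

definition shuffle_snd :: "nat \<Rightarrow> nat \<Rightarrow> nat \<Rightarrow> nat \<Rightarrow> nat" where
  "shuffle_snd m k l i = (i div (k * l) mod m) * l + i mod (k * l) mod l"

text \<open>An index below the product forces \<open>m\<close>, \<open>k\<close> and
  \<open>l\<close> to be positive, so each of its four mixed-radix digits lies in its range.\<close>

lemma shuffle_bounds:
  fixes i :: nat
  assumes "i < n * m * (k * l)"
  shows "i div (k * l) div m < n" "i div (k * l) mod m < m"
    "i mod (k * l) div l < k" "i mod (k * l) mod l < l" "i div (k * l) < n * m" "i mod (k * l) < k * l"
proof -
  have "0 < n * m * (k * l)" using assms by linarith
  then have pos: "m > 0" "k > 0" "l > 0" by auto
  show a: "i div (k * l) < n * m" using assms by (rule less_mult_imp_div_less)
  then show "i div (k * l) div m < n" by (rule less_mult_imp_div_less)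
  show b: "i mod (k * l) < k * l" using pos by simp
  then show "i mod (k * l) div l < k" by (rule less_mult_imp_div_less)
  show "i div (k * l) mod m < m" "i mod (k * l) mod l < l" using pos by auto
qed

lemma shuffle_div_mod:
  fixes i :: nat
  assumes "i < n * m * (k * l)"
  shows "shuffle_fst m k l i div k = i div (k * l) div m"
    and "shuffle_fst m k l i mod k = i mod (k * l) div l"
    and "shuffle_snd m k l i div l = i div (k * l) mod m"
    and "shuffle_snd m k l i mod l = i mod (k * l) mod l"
  unfolding shuffle_fst_def shuffle_snd_def
  by (rule add_mult_div_mod[OF shuffle_bounds(3)[OF assms]]
      add_mult_div_mod[OF shuffle_bounds(4)[OF assms]])+

text \<open>Both sides encode the same quadruples of digits. The inverse \<open>g\<close> reads x
  and z off \<open>u\<close>, y and w off \<open>v\<close>, and encodes them again in the order x,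
  y, z, w.\<close>

lemma bij_betw_shuffle:
  "bij_betw (\<lambda>i. (shuffle_fst m k l i, shuffle_snd m k l i)) {..<n * m * (k * l)}
     ({..<n * k} \<times> {..<m * l})"
proof (rule bij_betwI[where
      g = "\<lambda>(u, v). (u div k * m + v div l) * (k * l) + (u mod k * l + v mod l)"])
  show "(\<lambda>i. (shuffle_fst m k l i, shuffle_snd m k l i))
      \<in> {..<n * m * (k * l)} \<rightarrow> {..<n * k} \<times> {..<m * l}"
    unfolding shuffle_fst_def shuffle_snd_def
    by (auto intro!: add_mult_less dest: shuffle_bounds)
next
  have bounds: "u div k < n" "u mod k < k" "v div l < m" "v mod l < l"
    if "u < n * k" "v < m * l" for u v
  proof -
    have "0 < n * k" "0 < m * l" using that by linarith+
    then have "k > 0" "l > 0" by auto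
    then show "u div k < n" "u mod k < k" "v div l < m" "v mod l < l"
      using that by (auto intro: less_mult_imp_div_less)
  qed
  then show "(\<lambda>(u, v). (u div k * m + v div l) * (k * l) + (u mod k * l + v mod l))
      \<in> {..<n * k} \<times> {..<m * l} \<rightarrow> {..<n * m * (k * l)}"
    by (auto intro!: add_mult_less)
  show "(\<lambda>i. (shuffle_fst m k l i, shuffle_snd m k l i))
      ((\<lambda>(u, v). (u div k * m + v div l) * (k * l) + (u mod k * l + v mod l)) x) = x"
    if "x \<in> {..<n * k} \<times> {..<m * l}" for x
  proof -
    obtain u v where x: "x = (u, v)" "u < n * k" "v < m * l" using \<open>x \<in> _\<close> by auto
    let ?w = "u mod k * l + v mod l" and ?z = "u div k * m + v div l"
    note b = bounds[OF x(2,3)]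
    have w: "?w < k * l" using b by (intro add_mult_less)
    then have "(?z * (k * l) + ?w) div (k * l) = ?z" "(?z * (k * l) + ?w) mod (k * l) = ?w"
      by (rule add_mult_div_mod)+
    moreover have "?w div l = u mod k" "?w mod l = v mod l"
      by (rule add_mult_div_mod[OF b(4)])+
    moreover have "?z div m = u div k" "?z mod m = v div l"
      by (rule add_mult_div_mod[OF b(3)])+
    ultimately show ?thesis by (simp add: x(1) shuffle_fst_def shuffle_snd_def del: mod_mult_self3 div_mult_self3)
  qed
  show "(\<lambda>(u, v). (u div k * m + v div l) * (k * l) + (u mod k * l + v mod l))
      ((\<lambda>i. (shuffle_fst m k l i, shuffle_snd m k l i)) i) = i"
    if "i \<in> {..<n * m * (k * l)}" for i
  proof -
    have "i < n * m * (k * l)" using that by simp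
    from shuffle_div_mod[OF this] show ?thesis by (simp only: prod.case div_mult_mod_eq)
  qed
qed

interpretation sh: index_split "n * m * (k * l)" "n * k" "m * l" "shuffle_fst m k l" "shuffle_snd m k l"
  for n m k l
  by unfold_locales (rule bij_betw_shuffle)

text \<open>Each entry on either side is the product of the same four entries, one per digit. The
  effect is to exchange the factors \<open>B\<close> and \<open>C\<close>.\<close>

lemma shuffle_tens:
  "sh.tens n m k l (kr.tens n k A B) (kr.tens m l C D)
     = kr.tens (n * m) (k * l) (kr.tens n m A C) (kr.tens k l B D)"
proof (rule eq_matI)
  fix i j
  assume "i < dim_row (kr.tens (n * m) (k * l) (kr.tens n m A C) (kr.tens k l B D))"
    and "j < dim_col (kr.tens (n * m) (k * l) (kr.tens n m A C) (kr.tens k l B D))"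
  then have ij: "i < n * m * (k * l)" "j < n * m * (k * l)" by auto
  show "sh.tens n m k l (kr.tens n k A B) (kr.tens m l C D) $$ (i, j)
     = kr.tens (n * m) (k * l) (kr.tens n m A C) (kr.tens k l B D) $$ (i, j)"
    using ij sh.index_less[OF ij(1)] sh.index_less[OF ij(2)]
      shuffle_bounds[OF ij(1)] shuffle_bounds[OF ij(2)]
    by (simp add: shuffle_div_mod[OF ij(1)] shuffle_div_mod[OF ij(2)])
qed auto

text \<open>By linearity in each argument, elementary tensors suffice, and there
  \<open>shuffle_tens\<close> brings together the two graph algebras and the two auxiliary
  algebras.\<close>

lemma shuffle_in_tensor:
  assumes "M \<subseteq> carrier_mat n n" "N \<subseteq> carrier_mat k k" "M' \<subseteq> carrier_mat m m" "L \<subseteq> carrier_mat l l"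
    and "E \<in> tensor n M k N" "Q \<in> tensor m M' l L"
  shows "sh.tens n m k l E Q \<in> tensor (n * m) (tensor n M m M') (k * l) (tensor k N l L)"
    (is "_ \<in> ?T")
proof -
  note MM = lin_subspaceD(1)[OF lin_subspace_tensor[OF assms(1,3)]]
  note NN = lin_subspaceD(1)[OF lin_subspace_tensor[OF assms(2,4)]]
  note T = lin_subspaceD[OF lin_subspace_tensor[OF MM NN]]
  note Q_sub = lin_subspaceD(1)[OF lin_subspace_tensor[OF assms(3,4)]]
  show ?thesis using assms(5,1,2)
  proof (induction E rule: tensor_induct)
    case (base A B)
    note AB = this
    show ?case using assms(6,3,4)
    proof (induction Q rule: tensor_induct)
      case (base C D)
      show ?case
        unfolding shuffle_tens using AB base assms
        by (intro tens_in_tensor MM NN) auto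
    next
      case zero
      show ?case by (simp add: sh.tens_zero T(2))
    next
      case (add X Y)
      then show ?case by (simp add: sh.tens_add_right T(3))
    next
      case (smult c X)
      then show ?case by (simp add: sh.tens_smult_right T(4))
    qed
  next
    case zero
    show ?case by (simp add: sh.tens_zero T(2))
  next
    case (add X Y)
    then show ?case by (simp add: sh.tens_add_left T(3))
  next
    case (smult c X)
    then show ?case by (simp add: sh.tens_smult_left T(4))
  qed
qed

subsection \<open>Commuting projections\<close>

text \<open>Since a projection is its adjoint times itself, a diagonal entry is the squared norm of
  its column. A vanishing diagonal entry therefore kills the whole column.\<close>

lemma projection_diag:
  assumes "projection d F" "i < d"
  shows "Re (F $$ (i, i)) = (\<Sum>h<d. (cmod (F $$ (h, i)))\<^sup>2)"
proof -
  have F: "F \<in> carrier_mat d d" "F * F = F" "mat_adjoint F = F"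
    using assms unfolding projection_def by auto
  have "F $$ (i, i) = (\<Sum>h<d. F $$ (i, h) * F $$ (h, i))"
    using mat_mult_index[OF F(1) F(1) assms(2) assms(2)] F(2) by simp
  also have "\<dots> = (\<Sum>h<d. cnj (F $$ (h, i)) * F $$ (h, i))"
  proof (rule sum.cong)
    fix h assume "h \<in> {..<d}"
    then have "F $$ (i, h) = cnj (F $$ (h, i))"
      using mat_adjoint_index[of i F h] F assms(2) by simp
    then show "F $$ (i, h) * F $$ (h, i) = cnj (F $$ (h, i)) * F $$ (h, i)" by simp
  qed simp
  also have "\<dots> = (\<Sum>h<d. of_real ((cmod (F $$ (h, i)))\<^sup>2))"
    by (intro sum.cong) (simp_all only: complex_norm_square mult.commute)
  finally show ?thesis by simp
qed

text \<open>Commutation turns \<open>E * F * (E * F)\<close> into \<open>E * E * (F * F)\<close> and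
  the adjoint \<open>F * E\<close> back into \<open>E * F\<close>.\<close>

lemma projection_mult:
  assumes "projection d E" "projection d F" "E * F = F * E"
  shows "projection d (E * F)"
proof -
  have E: "E \<in> carrier_mat d d" "E * E = E" "mat_adjoint E = E"
    and F: "F \<in> carrier_mat d d" "F * F = F" "mat_adjoint F = F"
    using assms unfolding projection_def by auto
  have "E * F * (E * F) = E * (F * E) * F"
    using E F by (simp add: assoc_mult_mat[where n\<^sub>1 = d and n\<^sub>2 = d and n\<^sub>3 = d and n\<^sub>4 = d])
  also have "\<dots> = E * E * (F * F)"
    unfolding assms(3)[symmetric] using E(1) F(1)
    by (simp add: assoc_mult_mat[where n\<^sub>1 = d and n\<^sub>2 = d and n\<^sub>3 = d and n\<^sub>4 = d])
  finally show ?thesis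
    unfolding projection_def using E F assms(3)
    by (auto simp: mat_adjoint_mult[where r = d and m = d and c = d])
qed

text \<open>
  Each diagonal entry of a projection is a sum of squared moduli, so if projections sum to the
  identity then the products with a fixed one have non-negative diagonals summing to zero.
\<close>

lemma commuting_projections_orthogonal:
  assumes fin: "finite S" and proj: "\<And>s. s \<in> S \<Longrightarrow> projection d (E s)"
    and comm: "\<And>s t. s \<in> S \<Longrightarrow> t \<in> S \<Longrightarrow> E s * E t = E t * E s"
    and sum1: "msum d E S = 1\<^sub>m d"
    and st: "s \<in> S" "t \<in> S" "s \<noteq> t"
  shows "E s * E t = 0\<^sub>m d d"
proof (rule eq_matI)
  have car: "E u \<in> carrier_mat d d" if "u \<in> S" for u
    using proj[OF that] unfolding projection_def by auto
  have idem: "E s * E s = E s" using proj[OF st(1)] unfolding projection_def by auto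
  have pr: "projection d (E s * E u)" if "u \<in> S" for u
    using that st proj comm by (intro projection_mult) auto
  fix h i assume "h < dim_row (0\<^sub>m d d :: complex mat)" "i < dim_col (0\<^sub>m d d :: complex mat)"
  then have hi: "h < d" "i < d" by auto
  have nonneg: "Re ((E s * E u) $$ (i, i)) \<ge> 0" if "u \<in> S" for u
    unfolding projection_diag[OF pr[OF that] hi(2)] by (intro sum_nonneg) auto
  \<comment> \<open>The sum that equals the identity is multiplied by \<open>E s\<close>. The term
    \<open>u = s\<close> is \<open>E s\<close> itself and cancels against the left side, so the
    remaining diagonal entries sum to zero.\<close>
  have "E s = E s * msum d E S" using car[OF st(1)] unfolding sum1 by simp
  also have "\<dots> = msum d (\<lambda>u. E s * E u) S"
    using car st by (intro msum_mult_left) auto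
  finally have "E s $$ (i, i) = msum d (\<lambda>u. E s * E u) S $$ (i, i)" by simp
  also have "\<dots> = (\<Sum>u\<in>S. (E s * E u) $$ (i, i))" using hi by simp
  also have "\<dots> = (E s * E s) $$ (i, i) + (\<Sum>u\<in>S - {s}. (E s * E u) $$ (i, i))"
    using fin st by (intro sum.remove)
  finally have "(\<Sum>u\<in>S - {s}. (E s * E u) $$ (i, i)) = 0" unfolding idem by simp
  then have "(\<Sum>u\<in>S - {s}. Re ((E s * E u) $$ (i, i))) = 0"
    by (metis Re_sum zero_complex.simps(1))
  then have "Re ((E s * E t) $$ (i, i)) = 0"
    using nonneg fin st by (subst (asm) sum_nonneg_eq_0_iff) auto
  then have "(\<Sum>h<d. (cmod ((E s * E t) $$ (h, i)))\<^sup>2) = 0"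
    unfolding projection_diag[OF pr[OF st(2)] hi(2)] .
  then have "(cmod ((E s * E t) $$ (h, i)))\<^sup>2 = 0"
    using hi by (subst (asm) sum_nonneg_eq_0_iff) auto
  then show "(E s * E t) $$ (h, i) = 0\<^sub>m d d $$ (h, i)" using hi by simp
qed (use st proj in \<open>auto simp: projection_def\<close>)

section \<open>Products of commuting projections along a list\<close>

lemma projection_carrier: "projection d P \<Longrightarrow> P \<in> carrier_mat d d"
  unfolding projection_def by auto

text \<open>The product behind \<open>set_prod\<close>, taken over an arbitrary list so that
  induction on the list is possible.\<close>

abbreviation list_prod :: "nat \<Rightarrow> ('a \<Rightarrow> complex mat) \<Rightarrow> 'a list \<Rightarrow> complex mat" where
  "list_prod d P xs \<equiv> foldr (*) (map P xs) (1\<^sub>m d)"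

lemma list_prod_in_algebra:
  assumes "vn_algebra d M" "\<And>x. x \<in> set xs \<Longrightarrow> P x \<in> M"
  shows "list_prod d P xs \<in> M"
  using assms(2)
  by (induction xs) (use assms(1) in \<open>auto simp: vn_algebra_def\<close>)

lemma list_prod_carrier:
  assumes "\<And>x. x \<in> set xs \<Longrightarrow> P x \<in> carrier_mat d d"
  shows "list_prod d P xs \<in> carrier_mat d d"
  using assms by (induction xs) (auto intro: mult_carrier_mat)

lemma list_prod_commutes:
  assumes "Z \<in> carrier_mat d d"
    and "\<And>x. x \<in> set xs \<Longrightarrow> P x \<in> carrier_mat d d"
    and "\<And>x. x \<in> set xs \<Longrightarrow> Z * P x = P x * Z"
  shows "Z * list_prod d P xs = list_prod d P xs * Z"
  using assms(2,3)
proof (induction xs)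
  case (Cons x xs)
  let ?R = "list_prod d P xs"
  note assoc = assoc_mult_mat[where n\<^sub>1 = d and n\<^sub>2 = d and n\<^sub>3 = d and n\<^sub>4 = d]
  have R: "?R \<in> carrier_mat d d" using Cons.prems by (intro list_prod_carrier) auto
  have x: "P x \<in> carrier_mat d d" "Z * P x = P x * Z" using Cons.prems by auto
  have "Z * (P x * ?R) = Z * P x * ?R" by (rule assoc[symmetric, OF assms(1) x(1) R])
  also have "\<dots> = P x * (Z * ?R)" unfolding x(2) by (rule assoc[OF x(1) assms(1) R])
  also have "Z * ?R = ?R * Z" using Cons by auto
  also have "P x * (?R * Z) = P x * ?R * Z" by (rule assoc[symmetric, OF x(1) R assms(1)])
  finally show ?case by simp
qed (use assms(1) in simp)

lemma projection_list_prod: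
  assumes "\<And>x. x \<in> set xs \<Longrightarrow> projection d (P x)"
    and "\<And>x y. x \<in> set xs \<Longrightarrow> y \<in> set xs \<Longrightarrow> P x * P y = P y * P x"
  shows "projection d (list_prod d P xs)"
  using assms
proof (induction xs)
  case Nil
  have "mat_adjoint (1\<^sub>m d :: complex mat) = 1\<^sub>m d" by (rule eq_matI) auto
  then show ?case by (simp add: projection_def)
next
  case (Cons x xs)
  have "projection d (P x * list_prod d P xs)"
  proof (rule projection_mult)
    show "P x * list_prod d P xs = list_prod d P xs * P x"
      using Cons.prems by (intro list_prod_commutes) (auto intro: projection_carrier)
  qed (use Cons in auto)
  then show ?case by simp
qed

text \<open>\<open>P a\<close> commutes past the factors in front of its own occurrence and is
  absorbed there by idempotence.\<close>

lemma list_prod_absorb: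
  assumes "a \<in> set xs" "\<And>x. x \<in> set xs \<Longrightarrow> projection d (P x)"
    and "\<And>x y. x \<in> set xs \<Longrightarrow> y \<in> set xs \<Longrightarrow> P x * P y = P y * P x"
  shows "P a * list_prod d P xs = list_prod d P xs"
  using assms
proof (induction xs)
  case (Cons x xs)
  let ?R = "list_prod d P xs"
  note assoc = assoc_mult_mat[where n\<^sub>1 = d and n\<^sub>2 = d and n\<^sub>3 = d and n\<^sub>4 = d]
  have R: "?R \<in> carrier_mat d d"
    using Cons.prems by (intro list_prod_carrier) (auto intro: projection_carrier)
  have x: "P x \<in> carrier_mat d d" "P a \<in> carrier_mat d d"
    using Cons.prems by (auto intro: projection_carrier)
  show ?case
  proof (cases "a = x")
    case True
    have "P x * P x = P x" using Cons.prems(2)[of x] by (simp add: projection_def)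
    with True x R show ?thesis by (simp flip: assoc)
  next
    case False
    have "P a * (P x * ?R) = P a * P x * ?R" using x R by (simp add: assoc)
    also have "P a * P x = P x * P a" using Cons.prems by auto
    also have "P x * P a * ?R = P x * (P a * ?R)" using x R by (simp add: assoc)
    also have "P a * ?R = ?R" using Cons False by auto
    finally show ?thesis by simp
  qed
qed simp

subsection \<open>Colorings of the lexicographic product\<close>

text \<open>A finite value rules out the empty set of colorings, whose infimum is infinite, and a
  nonempty set of extended naturals contains its infimum.\<close>

lemma chi_q_attained:
  assumes "chi_q G = enat c"
  shows "\<exists>k N P. q_coloring G c k N P"
proof -
  let ?S = "enat ` {c. \<exists>k N P. q_coloring G c k N P}"
  have "?S \<noteq> {}" using assms unfolding chi_q_def by (auto simp: Inf_enat_def split: if_splits)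
  moreover from this obtain x where "x \<in> ?S" by blast
  then have "(LEAST x. x \<in> ?S) \<in> ?S" by (rule LeastI)
  ultimately have "Inf ?S \<in> ?S" by (simp only: Inf_enat_def if_False)
  then show ?thesis using assms unfolding chi_q_def by auto
qed

text \<open>The map taking \<open>X\<close> to the compression of X tensor I by \<open>R\<close> is
  linear, so its vanishing can be tested on elementary tensors.\<close>

lemma compression_tensor_zero:
  assumes "X \<in> tensor n V m W" "V \<subseteq> carrier_mat n n" "W \<subseteq> carrier_mat m m"
    and R: "R \<in> carrier_mat (n * m * k) (n * m * k)"
    and el: "\<And>A B. A \<in> V \<Longrightarrow> B \<in> W \<Longrightarrow>
      R * kr.tens (n * m) k (kr.tens n m A B) (1\<^sub>m k) * R = 0\<^sub>m (n * m * k) (n * m * k)"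
  shows "R * kr.tens (n * m) k X (1\<^sub>m k) * R = 0\<^sub>m (n * m * k) (n * m * k)"
  using assms(1-3)
proof (induction X rule: tensor_induct)
  let ?d = "n * m * k"
  {
    case (base A B)
    then show ?case by (rule el)
  next
    case zero
    then show ?case
      using R by (simp add: kr.tens_zero left_mult_zero_mat[where nr = ?d] right_mult_zero_mat[where n = ?d])
  next
    case (add X Y)
    then show ?case
      using R by (simp add: kr.tens_add_left mult_add_distrib_mat[where nr = ?d and n = ?d and nc = ?d]
          add_mult_distrib_mat[where nr = ?d and n = ?d and nc = ?d])
  next
    case (smult c X)
    then show ?case
      using R by (simp add: kr.tens_smult_left mult_smult_distrib[where nr = ?d and n = ?d and nc = ?d]
          mult_smult_assoc_mat[where nr = ?d and n = ?d and nc = ?d])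
  }
qed

text \<open>The two colorings act on the spaces of sizes \<open>n * k\<close> and
  \<open>m * l\<close>, while the product needs the order \<open>n\<close>, \<open>m\<close>,
  \<open>k\<close>, \<open>l\<close>. Hence the operators are built with \<open>sh.tens\<close>, and
  the auxiliary algebra is the tensor product of the two given ones.\<close>

lemma q_coloring_lex_product:
  assumes G: "quantum_graph G" and H: "quantum_graph H"
    and P: "qb_coloring b G c k N P" and Q: "q_coloring H b l L Q"
  shows "\<exists>R. q_coloring (lex_product G H) c (k * l) (tensor k N l L) R"
proof -
  define n where "n = hdim G"
  define m where "m = hdim H"
  define M where "M = alg G"
  define M' where "M' = alg H"
  define \<A> where "\<A> = {A. A \<subseteq> {1..c} \<and> card A = b}"
  define E where "E = set_prod (n * k) P"
  define D where "D = n * m * (k * l)"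
  have k: "k > 0" and l: "l > 0" and N: "vn_algebra k N" and L: "vn_algebra l L"
    using P Q by (auto simp: qb_coloring_def q_coloring_def)
  have M: "vn_algebra n M" and M': "vn_algebra m M'"
    using G H by (auto simp: quantum_graph_def n_def m_def M_def M'_def)
  have SG: "opspace G \<subseteq> carrier_mat n n" and SH: "opspace H \<subseteq> carrier_mat m m"
    using G H by (auto simp: quantum_graph_def n_def m_def lin_subspace_iff)
  have M'c: "commutant n M \<subseteq> carrier_mat n n" by (auto simp: commutant_def)
  note car = vn_algebra_carrier[OF M] vn_algebra_carrier[OF N]
    vn_algebra_carrier[OF M'] vn_algebra_carrier[OF L]
  have PM: "P a \<in> tensor n M k N" and Pp: "projection (n * k) (P a)" if "a \<in> {1..c}" for a
    using P that by (auto simp: qb_coloring_def n_def M_def)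
  have Pcomm: "P a * P a' = P a' * P a" if "a \<in> {1..c}" "a' \<in> {1..c}" for a a'
    using P that unfolding qb_coloring_def by blast
  have P0: "P a * kr.tens n k X (1\<^sub>m k) * P a = 0\<^sub>m (n * k) (n * k)"
    if "a \<in> {1..c}" "X \<in> opspace G" for a X
  proof -
    have "kr.tens n k X (1\<^sub>m k) = kron X (1\<^sub>m k)"
      using that SG by (intro kron_eq_tens[symmetric]) auto
    then show ?thesis using P that by (auto simp: qb_coloring_def n_def)
  qed
  have QM: "Q a \<in> tensor m M' l L" and Qp: "projection (m * l) (Q a)" if "a \<in> {1..b}" for a
    using Q that by (auto simp: q_coloring_def m_def M'_def)
  have Q0: "Q a * kr.tens m l X (1\<^sub>m l) * Q a = 0\<^sub>m (m * l) (m * l)"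
    if "a \<in> {1..b}" "X \<in> opspace H" for a X
  proof -
    have "kr.tens m l X (1\<^sub>m l) = kron X (1\<^sub>m l)"
      using that SH by (intro kron_eq_tens[symmetric]) auto
    then show ?thesis using Q that by (auto simp: q_coloring_def m_def)
  qed
  have Qsum: "msum (m * l) Q {1..b} = 1\<^sub>m (m * l)"
    using Q Qp by (subst finsum_eq_msum[symmetric])
      (auto simp: q_coloring_def m_def intro: projection_carrier)
  have fin: "finite \<A>" unfolding \<A>_def by auto
  have elems: "finite A" "A \<subseteq> {1..c}" "card A = b" if "A \<in> \<A>" for A
  proof -
    show A: "A \<subseteq> {1..c}" "card A = b" using that by (auto simp: \<A>_def)
    then show "finite A" using finite_subset by blast
  qed
  have colors: "x \<in> {1..c}" if "A \<in> \<A>" "x \<in> set (sorted_list_of_set A)" for A x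
    using elems[OF that(1)] that(2) by (simp only: set_sorted_list_of_set subset_iff)
  have Ep: "projection (n * k) (E A)" if "A \<in> \<A>" for A
    unfolding E_def set_prod_def
    by (intro projection_list_prod Pp Pcomm colors[OF that])
  note Ec = projection_carrier[OF Ep]
  have EM: "E A \<in> tensor n M k N" if "A \<in> \<A>" for A
    unfolding E_def set_prod_def
    by (intro list_prod_in_algebra vn_algebra_tensor M N PM colors[OF that])
  have PE: "P a * E A = E A" if "A \<in> \<A>" "a \<in> A" for a A
    unfolding E_def set_prod_def
    by (intro list_prod_absorb Pp Pcomm colors[OF that(1)]) (simp_all add: elems[OF that(1)] that(2))
  have PEcomm: "P a * E A = E A * P a" if "A \<in> \<A>" "a \<in> {1..c}" for a A
    unfolding E_def set_prod_def
    by (intro list_prod_commutes projection_carrier Pp Pcomm colors[OF that(1)] that(2))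
  have Ecomm: "E A * E B = E B * E A" if "A \<in> \<A>" "B \<in> \<A>" for A B
  proof -
    have "E A * list_prod (n * k) P (sorted_list_of_set B) = list_prod (n * k) P (sorted_list_of_set B) * E A"
      by (intro list_prod_commutes Ec[OF that(1)] projection_carrier[OF Pp] colors[OF that(2)]
          PEcomm[OF that(1), symmetric])
    then show ?thesis by (simp add: E_def set_prod_def)
  qed
  have Esum: "msum (n * k) E \<A> = 1\<^sub>m (n * k)"
    using P Ec fin by (subst finsum_eq_msum[symmetric])
      (auto simp: qb_coloring_def n_def E_def \<A>_def)
  have Eorth: "E A * E B = 0\<^sub>m (n * k) (n * k)" if "A \<in> \<A>" "B \<in> \<A>" "A \<noteq> B" for A B
    using commuting_projections_orthogonal[OF fin Ep Ecomm Esum that] .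
  \<comment> \<open>Each subset in the family has as many elements as \<open>Q\<close> has
    colors.\<close>
  have "\<exists>g. bij_betw g A {1..b}" if "A \<in> \<A>" for A
    using elems[OF that] by (intro finite_same_card_bij) auto
  then obtain g where g: "\<And>A. A \<in> \<A> \<Longrightarrow> bij_betw (g A) A {1..b}" by metis
  \<comment> \<open>The value zero outside \<open>A\<close> lets the sum defining \<open>R a\<close>
    below run over the whole family, instead of the subsets containing \<open>a\<close>.\<close>
  define F where "F = (\<lambda>A a. if a \<in> A then Q (g A a) else 0\<^sub>m (m * l) (m * l))"
  have gb: "g A a \<in> {1..b}" if "A \<in> \<A>" "a \<in> A" for A a
    using bij_betwE[OF g[OF that(1)]] that(2) by auto
  have Fp: "projection (m * l) (F A a)" if "A \<in> \<A>" for A a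
    using gb[OF that] Qp by (auto simp: F_def projection_def mat_adjoint_zero)
  note Fc = projection_carrier[OF Fp]
  have FM: "F A a \<in> tensor m M' l L" if "A \<in> \<A>" for A a
    using gb[OF that] QM lin_subspaceD(2)[OF lin_subspace_tensor[OF car(3,4)]] by (auto simp: F_def)
  have F0: "F A a * kr.tens m l X (1\<^sub>m l) * F A a = 0\<^sub>m (m * l) (m * l)"
    if "A \<in> \<A>" "X \<in> opspace H" for A a X
    using gb[OF that(1)] Q0 that(2)
    by (auto simp: F_def left_mult_zero_mat[where nr = "m * l"] right_mult_zero_mat[where n = "m * l"])
  \<comment> \<open>Only the colors in \<open>A\<close> contribute, and \<open>g A\<close> matches
    them with the colors of \<open>Q\<close>.\<close>
  have Fsum: "msum (m * l) (F A) {1..c} = 1\<^sub>m (m * l)" if "A \<in> \<A>" for A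
  proof -
    note A = elems[OF that]
    have "msum (m * l) (F A) {1..c} = msum (m * l) Q {1..b}"
    proof (rule eq_matI)
      fix i j assume "i < dim_row (msum (m * l) Q {1..b})" "j < dim_col (msum (m * l) Q {1..b})"
      then have ij: "i < m * l" "j < m * l" by auto
      have "(\<Sum>a\<in>{1..c}. F A a $$ (i, j)) = (\<Sum>a\<in>A. F A a $$ (i, j))"
        using A(1,2) ij by (intro sum.mono_neutral_right) (auto simp: F_def)
      also have "\<dots> = (\<Sum>a\<in>A. Q (g A a) $$ (i, j))"
        by (intro sum.cong) (auto simp: F_def)
      also have "\<dots> = (\<Sum>a\<in>{1..b}. Q a $$ (i, j))"
        by (rule sum.reindex_bij_betw[OF g[OF that]])
      finally show "msum (m * l) (F A) {1..c} $$ (i, j) = msum (m * l) Q {1..b} $$ (i, j)"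
        using ij by simp
    qed auto
    then show ?thesis using Qsum by simp
  qed
  define T where "T = (\<lambda>A a. sh.tens n m k l (E A) (F A a))"
  define R where "R = (\<lambda>a. msum D (\<lambda>A. T A a) \<A>)"
  have Tc: "T A a \<in> carrier_mat D D" for A a unfolding T_def D_def by simp
  have Rc: "R a \<in> carrier_mat D D" for a unfolding R_def by simp
  note assoc = assoc_mult_mat[where n\<^sub>1 = D and n\<^sub>2 = D and n\<^sub>3 = D and n\<^sub>4 = D]
  \<comment> \<open>Expanding both copies of \<open>R a\<close> gives a double sum over pairs of
    subsets, so it is enough that each summand vanishes.\<close>
  have sandwich: "R a * Z * R a = 0\<^sub>m D D"
    if Z: "Z \<in> carrier_mat D D"
      and TZT: "\<And>A B. A \<in> \<A> \<Longrightarrow> B \<in> \<A> \<Longrightarrow> T A a * Z * T B a = 0\<^sub>m D D" for a Z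
  proof -
    have "R a * Z = msum D (\<lambda>A. T A a * Z) \<A>"
      unfolding R_def using Tc Z by (intro msum_mult_right) auto
    then have "R a * Z * R a = msum D (\<lambda>A. T A a * Z * R a) \<A>"
      by (simp only:) (intro msum_mult_right mult_carrier_mat[where n = D] Tc Z Rc)
    also have "\<dots> = 0\<^sub>m D D"
    proof (rule msum_zero)
      fix A assume A: "A \<in> \<A>"
      have "T A a * Z * R a = msum D (\<lambda>B. T A a * Z * T B a) \<A>"
        unfolding R_def by (intro msum_mult_left mult_carrier_mat[where n = D] Tc Z)
      also have "\<dots> = 0\<^sub>m D D" using TZT A by (intro msum_zero) auto
      finally show "T A a * Z * R a = 0\<^sub>m D D" .
    qed
    finally show ?thesis .
  qed
  have TT: "T A a * T B a = (if A = B then T A a else 0\<^sub>m D D)" if "A \<in> \<A>" "B \<in> \<A>" for A B a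
    using that Ec Fc Ep[OF that(1)] Fp[OF that(1)] Eorth[OF that]
    by (auto simp: T_def D_def sh.tens_mult sh.tens_zero projection_def)
  \<comment> \<open>By \<open>TT\<close> the summands of \<open>R a\<close> are idempotent and
    mutually orthogonal, so only diagonal terms survive in its square.\<close>
  have Rp: "projection D (R a)" for a
  proof -
    have "msum D (\<lambda>A. T A a) \<A> * R a = msum D (\<lambda>A. T A a * R a) \<A>"
      by (intro msum_mult_right Tc Rc)
    also have "\<dots> = msum D (\<lambda>A. T A a) \<A>"
    proof (rule msum_cong)
      fix A assume A: "A \<in> \<A>"
      have "T A a * R a = msum D (\<lambda>B. T A a * T B a) \<A>"
        unfolding R_def using Tc by (intro msum_mult_left) auto
      also have "\<dots> = T A a * T A a"
        using A TT Tc fin by (intro msum_eq_single) auto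
      finally show "T A a * R a = T A a" using TT[OF A A] by simp
    qed
    finally have "R a * R a = R a" by (simp add: R_def)
    moreover have "mat_adjoint (R a) = msum D (\<lambda>A. mat_adjoint (T A a)) \<A>"
      unfolding R_def using Tc by (intro mat_adjoint_msum) auto
    moreover have "msum D (\<lambda>A. mat_adjoint (T A a)) \<A> = R a"
      unfolding R_def T_def using Ec Fc Ep Fp
      by (intro msum_cong) (auto simp: sh.tens_adjoint projection_def)
    ultimately show ?thesis using Rc by (simp add: projection_def)
  qed
  have RM: "R a \<in> tensor (n * m) (tensor n M m M') (k * l) (tensor k N l L)" for a
  proof -
    have "lin_subspace D (tensor (n * m) (tensor n M m M') (k * l) (tensor k N l L))"
      unfolding D_def
      by (intro lin_subspace_tensor lin_subspaceD(1)[OF lin_subspace_tensor] car)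
    then show ?thesis
      unfolding R_def T_def using fin EM FM
      by (intro msum_in_lin_subspace shuffle_in_tensor car) auto
  qed
  have Rsum: "msum D R {1..c} = 1\<^sub>m D"
  proof -
    \<comment> \<open>After the exchange of sums, the sum over the colors turns the second factor
      into the identity, and the sum over the subsets does the same for the first.\<close>
    have "msum D R {1..c} = msum D (\<lambda>A. msum D (T A) {1..c}) \<A>"
      unfolding R_def by (rule msum_swap)
    also have "\<dots> = msum D (\<lambda>A. sh.tens n m k l (E A) (1\<^sub>m (m * l))) \<A>"
    proof (rule msum_cong)
      fix A assume A: "A \<in> \<A>"
      show "msum D (T A) {1..c} = sh.tens n m k l (E A) (1\<^sub>m (m * l))"
        unfolding Fsum[OF A, symmetric] sh.tens_msum_right T_def D_def ..
    qed
    also have "\<dots> = sh.tens n m k l (msum (n * k) E \<A>) (1\<^sub>m (m * l))"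
      unfolding sh.tens_msum_left D_def ..
    finally show ?thesis by (simp add: Esum sh.tens_one D_def)
  qed
  \<comment> \<open>X tensor Y tensor I is regrouped along the two colorings, so that its
    compression splits into a factor for \<open>P\<close> and a factor for \<open>Q\<close>.\<close>
  have lift: "kr.tens (n * m) (k * l) (kr.tens n m X Y) (1\<^sub>m (k * l))
      = sh.tens n m k l (kr.tens n k X (1\<^sub>m k)) (kr.tens m l Y (1\<^sub>m l))" for X Y
    unfolding shuffle_tens by (simp add: kr.tens_one)
  have R_SG: "R a * kr.tens (n * m) (k * l) (kr.tens n m X Y) (1\<^sub>m (k * l)) * R a = 0\<^sub>m D D"
    if a: "a \<in> {1..c}" and X: "X \<in> opspace G" and Y: "Y \<in> carrier_mat m m" for a X Y
    unfolding lift
  proof (rule sandwich)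
    fix A B assume A: "A \<in> \<A>" and B: "B \<in> \<A>"
    let ?X = "kr.tens n k X (1\<^sub>m k)" and ?Y = "kr.tens m l Y (1\<^sub>m l)"
    note c = Ec[OF A] Ec[OF B] Fc[OF A] Fc[OF B] projection_carrier[OF Pp[OF a]]
    note assoc' = assoc_mult_mat[where n\<^sub>1 = "n * k" and n\<^sub>2 = "n * k" and n\<^sub>3 = "n * k" and n\<^sub>4 = "n * k"]
    have eq: "T A a * sh.tens n m k l ?X ?Y * T B a
        = sh.tens n m k l (E A * ?X * E B) (F A a * ?Y * F B a)"
      unfolding T_def using c by (simp add: sh.tens_mult mult_carrier_mat[where n = "n * k"]
          mult_carrier_mat[where n = "m * l"])
    show "T A a * sh.tens n m k l ?X ?Y * T B a = 0\<^sub>m D D"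
    \<comment> \<open>If \<open>a\<close> lies in both subsets, the first tensor factor vanishes
      because \<open>P\<close> colors G; otherwise the second one does, by the default value in
      \<open>F\<close>.\<close>
    proof (cases "a \<in> A \<and> a \<in> B")
      case True
      \<comment> \<open>Both projections absorb \<open>P a\<close>, which exposes the compression of
        \<open>?X\<close> by \<open>P a\<close>.\<close>
      have "E A * ?X * E B = E A * P a * ?X * (P a * E B)"
        using PE[OF A] PE[OF B] PEcomm[OF A a] True by simp
      also have "\<dots> = E A * (P a * ?X * P a) * E B"
        using c by (simp add: assoc' mult_carrier_mat[where n = "n * k"])
      also have "\<dots> = 0\<^sub>m (n * k) (n * k)"
        unfolding P0[OF a X] using c
        by (simp add: left_mult_zero_mat[where nr = "n * k"] right_mult_zero_mat[where n = "n * k"])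
      finally show ?thesis unfolding eq by (simp add: sh.tens_zero D_def)
    next
      case False
      then have "F A a = 0\<^sub>m (m * l) (m * l) \<or> F B a = 0\<^sub>m (m * l) (m * l)"
        by (auto simp: F_def)
      then have "F A a * ?Y * F B a = 0\<^sub>m (m * l) (m * l)"
        using c carrier_matD(1)[OF c(3)[of a]]
        by (elim disjE) (simp_all add: left_mult_zero_mat[where nr = "m * l"]
            right_mult_zero_mat[where n = "m * l"] mult_carrier_mat[where n = "m * l"])
      then show ?thesis unfolding eq by (simp add: sh.tens_zero D_def)
    qed
  qed (simp add: D_def)
  have R_SH: "R a * kr.tens (n * m) (k * l) (kr.tens n m X Y) (1\<^sub>m (k * l)) * R a = 0\<^sub>m D D"
    if X: "X \<in> commutant n M" and Y: "Y \<in> opspace H" for a X Y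
    unfolding lift
  proof (rule sandwich)
    fix A B assume A: "A \<in> \<A>" and B: "B \<in> \<A>"
    let ?X = "kr.tens n k X (1\<^sub>m k)" and ?Y = "kr.tens m l Y (1\<^sub>m l)"
    note c = Ec[OF A] Ec[OF B] Fc[OF A] Fc[OF B]
    have eq: "T A a * sh.tens n m k l ?X ?Y * T B a
        = sh.tens n m k l (E A * ?X * E B) (F A a * ?Y * F B a)"
      unfolding T_def using c by (simp add: sh.tens_mult mult_carrier_mat[where n = "n * k"]
          mult_carrier_mat[where n = "m * l"])
    show "T A a * sh.tens n m k l ?X ?Y * T B a = 0\<^sub>m D D"
    \<comment> \<open>Equal subsets carry the same \<open>F A a\<close> on both sides, and it
      compresses \<open>?Y\<close> to zero. For different subsets \<open>?X\<close> moves out of the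
      way and orthogonality kills the first factor.\<close>
    proof (cases "A = B")
      case True
      then show ?thesis unfolding eq using F0[OF A Y] by (simp add: sh.tens_zero D_def)
    next
      case False
      have "E A * ?X = ?X * E A"
        using commutant_tensor_commutes[OF car(1,2) X EM[OF A]] by simp
      then have "E A * ?X * E B = ?X * (E A * E B)"
        using c by (simp add: assoc_mult_mat[where n\<^sub>1 = "n * k" and n\<^sub>2 = "n * k"
              and n\<^sub>3 = "n * k" and n\<^sub>4 = "n * k"])
      then show ?thesis
        unfolding eq Eorth[OF A B False]
        by (simp add: sh.tens_zero D_def right_mult_zero_mat[where n = "n * k"])
    qed
  qed (simp add: D_def)
  have R_lex: "R a * kron X (1\<^sub>m (k * l)) * R a = 0\<^sub>m D D"
    if a: "a \<in> {1..c}" and X: "X \<in> opspace (lex_product G H)" for a X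
  proof -
    let ?V = "tensor n (opspace G) m (carrier_mat m m)"
    let ?W = "tensor n (commutant n M) m (opspace H)"
    obtain Y Z where XYZ: "X = Y + Z" and Y: "Y \<in> ?V" and Z: "Z \<in> ?W"
      using X by (auto simp: lex_product_def n_def m_def M_def)
    let ?Y = "kr.tens (n * m) (k * l) Y (1\<^sub>m (k * l))"
    let ?Z = "kr.tens (n * m) (k * l) Z (1\<^sub>m (k * l))"
    have c: "Y \<in> carrier_mat (n * m) (n * m)" "Z \<in> carrier_mat (n * m) (n * m)"
      using Y Z lin_subspaceD(1)[OF lin_subspace_tensor[OF SG subset_refl]]
        lin_subspaceD(1)[OF lin_subspace_tensor[OF M'c SH]] by auto
    have c': "?Y \<in> carrier_mat D D" "?Z \<in> carrier_mat D D" by (auto simp: D_def)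
    have "R a * ?Y * R a = 0\<^sub>m D D"
      unfolding D_def
      by (rule compression_tensor_zero[OF Y SG subset_refl])
        (use Rc R_SG[OF a] in \<open>auto simp: D_def\<close>)
    moreover have "R a * ?Z * R a = 0\<^sub>m D D"
      unfolding D_def
      by (rule compression_tensor_zero[OF Z M'c SH]) (use Rc R_SH in \<open>auto simp: D_def\<close>)
    moreover have "kron X (1\<^sub>m (k * l)) = ?Y + ?Z"
      using c unfolding XYZ by (subst kron_eq_tens[where p = "n * m" and q = "k * l"])
        (auto simp: kr.tens_add_left)
    moreover have "R a * (?Y + ?Z) * R a = R a * ?Y * R a + R a * ?Z * R a"
      using Rc[of a] c' by (simp add: mult_add_distrib_mat[where nr = D and n = D and nc = D]
          add_mult_distrib_mat[where nr = D and n = D and nc = D])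
    ultimately show ?thesis by simp
  qed
  have "q_coloring (lex_product G H) c (k * l) (tensor k N l L) R"
    unfolding q_coloring_def
  proof (intro conjI ballI)
    have hd: "hdim (lex_product G H) = n * m"
      and al: "alg (lex_product G H) = tensor n M m M'"
      by (auto simp: lex_product_def n_def m_def M_def M'_def)
    note DD = D_def[symmetric]
    show "0 < k * l" using k l by simp
    show "vn_algebra (k * l) (tensor k N l L)" by (rule vn_algebra_tensor[OF N L])
    show "R a \<in> tensor (hdim (lex_product G H)) (alg (lex_product G H)) (k * l) (tensor k N l L)" for a
      unfolding hd al by (rule RM)
    show "projection (hdim (lex_product G H) * (k * l)) (R a)" for a
      unfolding hd DD by (rule Rp)
    show "finsum (mat_space (hdim (lex_product G H) * (k * l))) R {1..c}
        = 1\<^sub>m (hdim (lex_product G H) * (k * l))"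
      unfolding hd DD by (subst finsum_eq_msum[OF finite_atLeastAtMost Rc]) (rule Rsum)
    show "R a * kron X (1\<^sub>m (k * l)) * R a
        = 0\<^sub>m (hdim (lex_product G H) * (k * l)) (hdim (lex_product G H) * (k * l))"
      if "a \<in> {1..c}" "X \<in> opspace (lex_product G H)" for a X
      unfolding hd DD by (rule R_lex[OF that])
  qed
  then show ?thesis by (rule exI[of _ R])
qed

theorem theorem1:
  fixes G H :: qgraph and b :: nat
  assumes "quantum_graph G" and "quantum_graph H"
    and "chi_q H = enat b"
  shows "chi_q (lex_product G H) \<le> chi_bq b G"
  unfolding chi_bq_def
\<comment> \<open>It suffices to bound the left side by each number \<open>c\<close> of colors of a
  b-fold coloring of G, which also covers an infinite right side.\<close>
proof (rule INF_greatest)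
  fix c assume "c \<in> {c. \<exists>k N P. qb_coloring b G c k N P}"
  then obtain k N P where P: "qb_coloring b G c k N P" by auto
  obtain l L Q where Q: "q_coloring H b l L Q" using chi_q_attained[OF assms(3)] by auto
  show "chi_q (lex_product G H) \<le> enat c"
    unfolding chi_q_def
  proof (rule INF_lower)
    show "c \<in> {c. \<exists>k N P. q_coloring (lex_product G H) c k N P}"
      using q_coloring_lex_product[OF assms(1,2) P Q] by blast
  qed
qed

end
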